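(* Let $f=(f^1,f^2,f^3):\overline{\mathbb{U}}\to\mathbb{R}^3$ be continuous on $\overline{\mathbb{U}}$ and harmonic on the unit disk $\mathbb{U}$, and suppose that the curve $t\mapsto f(e^{it})$, $t\in[0,2\pi]$, is rectifiable. Let $d$ be the diameter of $S=f(\mathbb{U})$. Then a) $\pi\Lambda_f(0)\le 2d$; b) $\pi(1-|z|^2)\Lambda_f(z)\le 2d$ for every $z\in\mathbb{U}$.
   Context: $\mathbb{U}$ is the open unit disk in $\mathbb{C}$. A map into $\mathbb{R}^3$ is harmonic if its components are. $\Lambda_f(z)=\|(df)_z\|$ is the operator norm (with respect to Euclidean norms) of the differential of $f$ at $z$. *)

theory Defs
  imports "HOL-Analysis.Analysis"
begin

definition directional_deriv ::
    "'a::euclidean_space \<Rightarrow> ('a \<Rightarrow> real) \<Rightarrow> 'a \<Rightarrow> real" where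
  "directional_deriv b u x = frechet_derivative u (at x) b"

text \<open>Intended for open \<open>S\<close> only: derivatives are taken with respect to full neighbourhoods,
  and \<^const>\<open>frechet_derivative\<close> is meaningful only where differentiability is known.\<close>

definition C2_on :: "'a::euclidean_space set \<Rightarrow> ('a \<Rightarrow> real) \<Rightarrow> bool" where
  "C2_on S u \<longleftrightarrow>
     (\<forall>x\<in>S. u differentiable (at x)) \<and>
     (\<forall>b\<in>Basis. \<forall>x\<in>S. directional_deriv b u differentiable (at x)) \<and>
     (\<forall>b\<in>Basis. \<forall>c\<in>Basis. continuous_on S (directional_deriv c (directional_deriv b u)))"

definition laplacian :: "('a::euclidean_space \<Rightarrow> real) \<Rightarrow> 'a \<Rightarrow> real" where
  "laplacian u x = (\<Sum>b\<in>Basis. directional_deriv b (directional_deriv b u) x)"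

definition harmonic_on :: "'a::euclidean_space set \<Rightarrow> ('a \<Rightarrow> real) \<Rightarrow> bool" where
  "harmonic_on S u \<longleftrightarrow> C2_on S u \<and> (\<forall>x\<in>S. laplacian u x = 0)"

definition harmonic_map_on :: "'a::euclidean_space set \<Rightarrow> ('a \<Rightarrow> real ^ 'n) \<Rightarrow> bool" where
  "harmonic_map_on S f \<longleftrightarrow> (\<forall>i. harmonic_on S (\<lambda>x. f x $ i))"

text \<open>Finite length: the lengths of inscribed polygons are bounded. Continuity is not part of this
  predicate.\<close>

definition rectifiable_on :: "real \<Rightarrow> real \<Rightarrow> (real \<Rightarrow> 'a::metric_space) \<Rightarrow> bool" where
  "rectifiable_on a b g \<longleftrightarrow>
     (\<exists>L. \<forall>n. \<forall>t :: nat \<Rightarrow> real. mono_on {..n} t \<and> t ` {..n} \<subseteq> {a..b} \<longrightarrow>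
        (\<Sum>i<n. dist (g (t i)) (g (t (Suc i)))) \<le> L)"

definition differential_norm ::
    "('a::real_normed_vector \<Rightarrow> 'b::real_normed_vector) \<Rightarrow> 'a \<Rightarrow> real" where
  "differential_norm f z = onorm (frechet_derivative f (at z))"

end

theory Submission
  imports Defs "HOL-Complex_Analysis.Riemann_Mapping"
begin

text \<open>
  The estimate reduces to one scalar function at a time. If \<open>v\<close> is a vector and \<open>e\<close> is the unit vector
  in the direction of \<open>df\<^sub>z(v)\<close>, then \<open>\<parallel>df\<^sub>z(v)\<parallel>\<close> is the derivative at \<open>z\<close> along \<open>v\<close> of the harmonic function
  \<open>e \<bullet> f\<close>, and by the Cauchy-Schwarz inequality that function oscillates by at most the diameter \<open>d\<close>
  on the disc.

  A harmonic function on the disc is the real part of a holomorphic function \<open>F\<close>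
  (\<open>harmonic_is_Re_holomorphic\<close>), which then maps the disc into a vertical strip of width \<open>d\<close>. For such
  maps the sharp bound \<open>\<pi> (1 - \<bar>z\<bar>\<^sup>2) \<bar>F'(z)\<bar> \<le> 2 d\<close> is the Schwarz-Pick inequality for the strip. The
  tangent maps the strip \<open>\<bar>Re w\<bar> < \<pi>/4\<close> into the unit disc (\<open>norm_tan_less_1\<close>) and its derivative
  \<open>1 / cos\<^sup>2\<close> is at least 1 on the real axis, so rescaling \<open>F\<close> and making its value at \<open>z\<close> real turns the
  claim into \<open>(1 - \<bar>z\<bar>\<^sup>2) \<bar>g'(z)\<bar> \<le> 1\<close> for a self-map \<open>g\<close> of the disc. A disc automorphism moves \<open>z\<close> to the
  origin, where this is Cauchy's estimate (\<open>norm_deriv_le_disc_to_strip\<close>).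

  Continuity up to the boundary makes \<open>f\<close> bounded, so that the diameter of the image does bound the
  distances between values of \<open>f\<close>. The bound at the origin is the case \<open>z = 0\<close> of the general one.
\<close>

section \<open>Symmetry of second derivatives\<close>

lemma has_real_derivative_along_line:
  fixes u :: "'a::euclidean_space \<Rightarrow> real"
  assumes "u differentiable (at (q + s *\<^sub>R b))"
  shows "((\<lambda>t. u (q + t *\<^sub>R b)) has_real_derivative directional_deriv b u (q + s *\<^sub>R b)) (at s)"
proof -
  let ?D = "frechet_derivative u (at (q + s *\<^sub>R b))"
  have u: "(u has_derivative ?D) (at (q + s *\<^sub>R b))"
    using assms by (simp add: frechet_derivative_works)
  have line: "((\<lambda>t. q + t *\<^sub>R b) has_derivative (\<lambda>t. t *\<^sub>R b)) (at s)"
    by (auto intro!: derivative_eq_intros)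
  have "((\<lambda>t. u (q + t *\<^sub>R b)) has_derivative (\<lambda>t. ?D (t *\<^sub>R b))) (at s)"
    by (rule has_derivative_compose[OF line u])
  moreover have "?D (t *\<^sub>R b) = t * directional_deriv b u (q + s *\<^sub>R b)" for t
    using linear_frechet_derivative[OF assms]
    by (simp add: directional_deriv_def linear_cmul)
  ultimately show ?thesis
    by (simp add: has_field_derivative_def mult.commute[of _ "directional_deriv _ _ _"])
qed

text \<open>
  The second difference over a square is symmetric in the two directions, whereas the mean value
  theorem, applied along \<open>b\<close> and then along \<open>c\<close>, expresses it through one order of differentiation.
\<close>

lemma second_difference_eq_second_derivative:
  fixes u :: "'a::euclidean_space \<Rightarrow> real"
  assumes C2: "C2_on S u" and b: "b \<in> Basis" and c: "c \<in> Basis"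
    and h: "h > 0" and sub: "cball p (2 * h) \<subseteq> S"
  obtains q where "q \<in> cball p (2 * h)"
    "u (p + h *\<^sub>R c + h *\<^sub>R b) - u (p + h *\<^sub>R c) - u (p + h *\<^sub>R b) + u p
      = h\<^sup>2 * directional_deriv c (directional_deriv b u) q"
proof -
  have near: "p + s *\<^sub>R c + t *\<^sub>R b \<in> cball p (2 * h)" if "0 \<le> s" "s \<le> h" "0 \<le> t" "t \<le> h" for s t
  proof -
    have "norm (s *\<^sub>R c + t *\<^sub>R b) \<le> norm (s *\<^sub>R c) + norm (t *\<^sub>R b)"
      by (rule norm_triangle_ineq)
    also have "\<dots> \<le> 2 * h" using that b c by simp
    finally show ?thesis
      by (metis add.assoc add_diff_cancel_left' dist_commute dist_norm mem_cball)
  qed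
  have u: "u differentiable (at (p + s *\<^sub>R c + t *\<^sub>R b))"
    if "0 \<le> s" "s \<le> h" "0 \<le> t" "t \<le> h" for s t
    using C2 sub near[OF that] unfolding C2_on_def by blast
  have u': "directional_deriv b u differentiable (at (p + s *\<^sub>R c + t *\<^sub>R b))"
    if "0 \<le> s" "s \<le> h" "0 \<le> t" "t \<le> h" for s t
    using C2 sub near[OF that] b unfolding C2_on_def by blast
  define \<phi> where "\<phi> = (\<lambda>t. u (p + h *\<^sub>R c + t *\<^sub>R b) - u (p + t *\<^sub>R b))"
  have "DERIV \<phi> t :> directional_deriv b u (p + h *\<^sub>R c + t *\<^sub>R b) - directional_deriv b u (p + t *\<^sub>R b)"
    if "0 \<le> t" "t \<le> h" for t
    unfolding \<phi>_def using u[of h t] u[of 0 t] that h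
    by (intro DERIV_diff has_real_derivative_along_line) auto
  from MVT2[OF h this] obtain t where t: "0 < t" "t < h" and
    \<phi>: "\<phi> h - \<phi> 0 = (h - 0) *
      (directional_deriv b u (p + h *\<^sub>R c + t *\<^sub>R b) - directional_deriv b u (p + t *\<^sub>R b))"
    by blast
  define \<psi> where "\<psi> = (\<lambda>s. directional_deriv b u ((p + t *\<^sub>R b) + s *\<^sub>R c))"
  have "DERIV \<psi> s :> directional_deriv c (directional_deriv b u) ((p + t *\<^sub>R b) + s *\<^sub>R c)"
    if "0 \<le> s" "s \<le> h" for s
    unfolding \<psi>_def using u'[of s t] that t
    by (intro has_real_derivative_along_line) (auto simp: algebra_simps)
  from MVT2[OF h this] obtain s where s: "0 < s" "s < h" and
    \<psi>: "\<psi> h - \<psi> 0 = (h - 0) * directional_deriv c (directional_deriv b u) ((p + t *\<^sub>R b) + s *\<^sub>R c)"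
    by blast
  show ?thesis
  proof
    show "p + s *\<^sub>R c + t *\<^sub>R b \<in> cball p (2 * h)" using near[of s t] s t by simp
    have "\<phi> h - \<phi> 0 = h * (\<psi> h - \<psi> 0)"
      unfolding \<phi> by (simp add: \<psi>_def algebra_simps)
    also have "\<dots> = h\<^sup>2 * directional_deriv c (directional_deriv b u) (p + s *\<^sub>R c + t *\<^sub>R b)"
      unfolding \<psi> by (simp add: power2_eq_square algebra_simps)
    finally show "u (p + h *\<^sub>R c + h *\<^sub>R b) - u (p + h *\<^sub>R c) - u (p + h *\<^sub>R b) + u p
      = h\<^sup>2 * directional_deriv c (directional_deriv b u) (p + s *\<^sub>R c + t *\<^sub>R b)"
      by (simp add: \<phi>_def)
  qed
qed

text \<open>
  Letting the side of the square tend to 0 in the two expressions for its second difference gives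
  the two mixed derivatives at the corner, by their continuity.
\<close>

lemma C2_on_mixed_partials_commute:
  fixes u :: "'a::euclidean_space \<Rightarrow> real"
  assumes C2: "C2_on S u" and S: "open S" "p \<in> S" and b: "b \<in> Basis" and c: "c \<in> Basis"
  shows "directional_deriv c (directional_deriv b u) p = directional_deriv b (directional_deriv c u) p"
proof -
  let ?cb = "directional_deriv c (directional_deriv b u)"
  let ?bc = "directional_deriv b (directional_deriv c u)"
  obtain e where e: "e > 0" "cball p e \<subseteq> S"
    using S open_contains_cball by blast
  define h where "h = (\<lambda>n. e / 2 * inverse (real (Suc n)))"
  have h: "h n > 0" "2 * h n \<le> e" for n
    using e by (auto simp: h_def field_simps)
  have h0: "(\<lambda>n. 2 * h n) \<longlonglongrightarrow> 0"
    unfolding h_def by (intro tendsto_mult_right_zero LIMSEQ_inverse_real_of_nat)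
  have sub: "cball p (2 * h n) \<subseteq> S" for n
    using e h(2)[of n] by (meson order_trans subset_cball)
  have "\<exists>q q'. q \<in> cball p (2 * h n) \<and> q' \<in> cball p (2 * h n) \<and> ?cb q = ?bc q'" for n
  proof -
    let ?h = "h n"
    obtain q where q: "q \<in> cball p (2 * ?h)"
      "u (p + ?h *\<^sub>R c + ?h *\<^sub>R b) - u (p + ?h *\<^sub>R c) - u (p + ?h *\<^sub>R b) + u p = ?h\<^sup>2 * ?cb q"
      using second_difference_eq_second_derivative[OF C2 b c h(1) sub] by blast
    obtain q' where q': "q' \<in> cball p (2 * ?h)"
      "u (p + ?h *\<^sub>R b + ?h *\<^sub>R c) - u (p + ?h *\<^sub>R b) - u (p + ?h *\<^sub>R c) + u p = ?h\<^sup>2 * ?bc q'"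
      using second_difference_eq_second_derivative[OF C2 c b h(1) sub] by blast
    have "?h\<^sup>2 * ?cb q = ?h\<^sup>2 * ?bc q'"
      unfolding q(2)[symmetric] q'(2)[symmetric] by (simp add: algebra_simps)
    then have "?cb q = ?bc q'" using h(1)[of n] by simp
    then show ?thesis using q q' by blast
  qed
  then obtain q q' where q: "\<And>n. q n \<in> cball p (2 * h n)" and q': "\<And>n. q' n \<in> cball p (2 * h n)"
    and eq: "\<And>n. ?cb (q n) = ?bc (q' n)"
    by metis
  have lim: "(\<lambda>n. D (r n)) \<longlonglongrightarrow> D p"
    if r: "\<And>n. r n \<in> cball p (2 * h n)" and D: "continuous_on S D" for r and D :: "'a \<Rightarrow> real"
  proof -
    have "r \<longlonglongrightarrow> p"
    proof (rule metric_LIMSEQ_I)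
      fix \<epsilon> :: real assume "\<epsilon> > 0"
      from LIMSEQ_D[OF h0 this] obtain N where "\<forall>n\<ge>N. norm (2 * h n - 0) < \<epsilon>" by blast
      then show "\<exists>N. \<forall>n\<ge>N. dist (r n) p < \<epsilon>"
        using r by (intro exI[of _ N]) (force simp: dist_commute intro: le_less_trans)
    qed
    moreover have "isCont D p"
      using D S by (simp add: continuous_on_eq_continuous_at)
    ultimately show ?thesis by (rule isCont_tendsto_compose[rotated])
  qed
  have cont: "continuous_on S ?cb" "continuous_on S ?bc"
    using C2 b c unfolding C2_on_def by blast+
  show ?thesis
    using LIMSEQ_unique[OF lim[OF q cont(1)]] lim[OF q' cont(2)] by (simp add: eq)
qed

section \<open>Planar harmonic functions as real parts\<close>

lemma frechet_derivative_complex_coordinates: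
  fixes u :: "complex \<Rightarrow> real"
  assumes "u differentiable (at z)"
  shows "frechet_derivative u (at z) v = Re v * directional_deriv 1 u z + Im v * directional_deriv \<i> u z"
proof -
  have v: "v = Re v *\<^sub>R 1 + Im v *\<^sub>R \<i>"
    by (simp add: complex_eq_iff)
  show ?thesis
    by (subst v)
      (simp only: linear_add[OF linear_frechet_derivative[OF assms]]
        linear_cmul[OF linear_frechet_derivative[OF assms]] directional_deriv_def real_scaleR_def)
qed

text \<open>
  For \<open>u\<^sub>x - \<i> u\<^sub>y\<close> the Cauchy-Riemann equations say that the Laplacian vanishes and that the mixed
  derivatives agree.
\<close>

lemma harmonic_complex_gradient_holomorphic:
  assumes u: "harmonic_on S u" and S: "open S"
  shows "(\<lambda>z. Complex (directional_deriv 1 u z) (- directional_deriv \<i> u z)) holomorphic_on S"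
proof -
  let ?x = "directional_deriv 1 u" and ?y = "directional_deriv \<i> u"
  have C2: "C2_on S u" using u by (simp add: harmonic_on_def)
  have "(\<lambda>z. Complex (?x z) (- ?y z)) field_differentiable (at z)" if z: "z \<in> S" for z
  proof -
    have diff: "?x differentiable (at z)" "?y differentiable (at z)"
      using C2 z unfolding C2_on_def by (auto simp: Basis_complex_def)
    have mixed: "directional_deriv \<i> ?x z = directional_deriv 1 ?y z"
      by (rule C2_on_mixed_partials_commute[OF C2 S z]) (auto simp: Basis_complex_def)
    have "laplacian u z = 0" using u z by (simp add: harmonic_on_def)
    then have laplace: "directional_deriv \<i> ?y z = - directional_deriv 1 ?x z"
      by (simp add: laplacian_def Basis_complex_def)
    have "((\<lambda>z. of_real (?x z) - \<i> * of_real (?y z)) has_derivative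
       (\<lambda>v. of_real (frechet_derivative ?x (at z) v) - \<i> * of_real (frechet_derivative ?y (at z) v))) (at z)"
      using diff unfolding frechet_derivative_works by (intro derivative_intros)
    moreover have "(\<lambda>z. of_real (?x z) - \<i> * of_real (?y z)) = (\<lambda>z. Complex (?x z) (- ?y z))"
      by (auto simp: complex_eq_iff)
    moreover have "(\<lambda>v. of_real (frechet_derivative ?x (at z) v) - \<i> * of_real (frechet_derivative ?y (at z) v))
      = (*) (Complex (directional_deriv 1 ?x z) (- directional_deriv 1 ?y z))"
      by (rule ext) (simp add: frechet_derivative_complex_coordinates[OF diff(1)]
          frechet_derivative_complex_coordinates[OF diff(2)] mixed laplace complex_eq_iff algebra_simps)
    ultimately show ?thesis
      unfolding field_differentiable_def has_field_derivative_def by auto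
  qed
  then show ?thesis by (simp add: holomorphic_on_def field_differentiable_at_within)
qed

text \<open>
  The real part of a primitive of \<open>u\<^sub>x - \<i> u\<^sub>y\<close> has the same differential as \<open>u\<close>, hence differs from it
  by a constant.
\<close>

lemma harmonic_is_Re_holomorphic:
  assumes u: "harmonic_on S u" and S: "open S" "convex S"
  obtains F where "F holomorphic_on S" "\<And>z. z \<in> S \<Longrightarrow> Re (F z) = u z"
proof -
  let ?G = "\<lambda>z. Complex (directional_deriv 1 u z) (- directional_deriv \<i> u z)"
  obtain G where G: "\<And>z. z \<in> S \<Longrightarrow> (G has_field_derivative ?G z) (at z within S)"
    using holomorphic_convex_primitive'[OF S(2,1) harmonic_complex_gradient_holomorphic[OF u S(1)]] by blast
  have "\<exists>k. \<forall>z\<in>S. u z - Re (G z) = k"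
  proof (rule has_derivative_zero_constant[OF S(2)])
    fix z assume z: "z \<in> S"
    have diff: "u differentiable (at z)"
      using u z by (auto simp: harmonic_on_def C2_on_def)
    have "((\<lambda>z. u z - Re (G z)) has_derivative
        (\<lambda>v. frechet_derivative u (at z) v - Re (?G z * v))) (at z within S)"
      using diff G[OF z] unfolding frechet_derivative_works has_field_derivative_def
      by (intro derivative_intros) (auto intro: has_derivative_at_withinI)
    then show "((\<lambda>z. u z - Re (G z)) has_derivative (\<lambda>v. 0)) (at z within S)"
      by (simp add: frechet_derivative_complex_coordinates[OF diff] algebra_simps)
  qed
  then obtain k where k: "\<And>z. z \<in> S \<Longrightarrow> u z - Re (G z) = k" by blast
  show ?thesis
  proof
    show "(\<lambda>z. G z + of_real k) holomorphic_on S"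
      using G by (intro holomorphic_intros) (auto simp: holomorphic_on_def field_differentiable_def)
    show "Re (G z + of_real k) = u z" if "z \<in> S" for z
      using k[OF that] by simp
  qed
qed

section \<open>Holomorphic maps of the disc into a strip\<close>

text \<open>Cauchy's estimate on the discs of radius \<open>r < 1\<close>, as \<open>r\<close> tends to 1.\<close>

lemma deriv_0_le_1_unit_disc:
  assumes h: "h holomorphic_on ball 0 1" and bound: "h ` ball 0 1 \<subseteq> ball 0 1"
  shows "norm (deriv h 0) \<le> 1"
proof -
  have "r * norm (deriv h 0) \<le> 1" if r: "0 < r" "r < 1" for r
  proof -
    have "norm ((deriv ^^ 1) h 0) \<le> fact 1 * 1 / r ^ 1"
    proof (rule Cauchy_higher_deriv_bound)
      show "h holomorphic_on ball 0 r"
        using h r by (auto intro: holomorphic_on_subset)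
      show "continuous_on (cball 0 r) h"
        using r by (intro continuous_on_subset[OF holomorphic_on_imp_continuous_on[OF h]]) auto
      show "h w \<in> ball 0 1" if "w \<in> ball 0 r" for w
        using that r bound by (auto simp: image_subset_iff)
    qed (use r in auto)
    then show ?thesis using r by (simp add: field_simps)
  qed
  then show ?thesis
    by (rule field_le_mult_one_interval)
qed

text \<open>
  The disc automorphism \<open>\<zeta> \<mapsto> (\<zeta> + a) / (1 + cnj a \<zeta>)\<close> takes 0 to \<open>a\<close> with derivative \<open>1 - \<bar>a\<bar>\<^sup>2\<close>, so
  the chain rule carries the estimate at the origin over to \<open>a\<close>.
\<close>

lemma norm_deriv_le_disc_to_disc:
  assumes g: "g holomorphic_on ball 0 1" and bound: "g ` ball 0 1 \<subseteq> ball 0 1" and a: "a \<in> ball 0 1"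
  shows "(1 - (norm a)\<^sup>2) * norm (deriv g a) \<le> 1"
proof -
  let ?m = "Moebius_function 0 (- a)"
  have a1: "norm (- a) < 1" and pos: "1 - (norm a)\<^sup>2 > 0" using a by (auto simp: abs_square_less_1)
  have m0: "?m 0 = a" by (simp add: Moebius_function_of_zero)
  have m: "?m ` ball 0 1 \<subseteq> ball 0 1"
    using Moebius_function_norm_lt_1[OF a1] by auto
  have m': "(?m has_field_derivative 1 - (norm a)\<^sup>2) (at 0)"
    unfolding Moebius_function_def
    by (auto intro!: derivative_eq_intros simp: complex_norm_square mult.commute simp flip: of_real_power)
  have g': "(g has_field_derivative deriv g a) (at (?m 0))"
    unfolding m0 using g a by (intro holomorphic_derivI[of _ "ball 0 1"]) auto
  have "deriv (g \<circ> ?m) 0 = deriv g a * (1 - (norm a)\<^sup>2)"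
    by (rule DERIV_imp_deriv, rule DERIV_chain[OF g' m'])
  moreover have "norm (deriv (g \<circ> ?m) 0) \<le> 1"
  proof (rule deriv_0_le_1_unit_disc)
    show "g \<circ> ?m holomorphic_on ball 0 1"
      by (rule holomorphic_on_compose_gen[OF Moebius_function_holomorphic[OF a1] g m])
    show "(g \<circ> ?m) ` ball 0 1 \<subseteq> ball 0 1"
      using m bound by (fastforce simp: image_subset_iff)
  qed
  moreover have "norm (1 - (of_real (norm a))\<^sup>2 :: complex) = 1 - (norm a)\<^sup>2"
    using pos by (metis abs_of_pos norm_of_real of_real_1 of_real_diff of_real_power)
  ultimately show ?thesis by (simp add: norm_mult mult.commute)
qed

text \<open>The reason is the identity \<open>\<bar>cos w\<bar>\<^sup>2 - \<bar>sin w\<bar>\<^sup>2 = cos (2 Re w)\<close>.\<close>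

lemma norm_tan_less_1:
  assumes "\<bar>Re w\<bar> < pi / 4"
  shows "cos w \<noteq> 0" "norm (tan w) < 1"
proof -
  have "cos (2 * Re w) > 0" using assms by (intro cos_gt_zero_pi) auto
  moreover have "(norm (cos w))\<^sup>2 - (norm (sin w))\<^sup>2 = cos (2 * Re w)"
  proof -
    have "((E - inverse E)\<^sup>2) / 4 - (E\<^sup>2 + inverse (E\<^sup>2) - 2) / 4 = 0" if "E \<noteq> 0" for E :: real
      using that by (simp add: power2_eq_square field_simps)
    from this[OF exp_not_eq_zero[of "Im w"]] show ?thesis
      unfolding norm_cos_squared norm_sin_squared exp_double cos_double_cos by argo
  qed
  ultimately have "(norm (sin w))\<^sup>2 < (norm (cos w))\<^sup>2" by simp
  then have *: "norm (sin w) < norm (cos w)" by (rule power2_less_imp_less) simp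
  then show "cos w \<noteq> 0" by auto
  then show "norm (tan w) < 1" using * by (simp add: tan_def norm_divide)
qed

text \<open>
  Composing with the tangent of the rescaled strip gives a self-map of the disc, and this does not
  decrease the rescaled derivative at a point where the argument of the tangent is real.
\<close>

lemma norm_deriv_le_disc_to_strip:
  assumes F: "F holomorphic_on ball 0 1" and r: "r > 0"
    and strip: "\<And>z. z \<in> ball 0 1 \<Longrightarrow> \<bar>Re (F z) - c\<bar> < r" and a: "a \<in> ball 0 1"
  shows "pi * (1 - (norm a)\<^sup>2) * norm (deriv F a) \<le> 4 * r"
proof -
  \<comment> \<open>Besides centring the strip, subtracting \<open>w0\<close> makes the argument of the tangent real at \<open>a\<close>.\<close>
  define w0 where "w0 = Complex c (Im (F a))"
  define k where "k = pi / (4 * r)"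
  have k: "k > 0" using r by (simp add: k_def)
  define L where "L = (\<lambda>z. of_real k * (F z - w0))"
  have ReL: "\<bar>Re (L z)\<bar> < pi / 4" if "z \<in> ball 0 1" for z
  proof -
    have "\<bar>Re (L z)\<bar> = k * \<bar>Re (F z) - c\<bar>" using k by (simp add: L_def w0_def abs_mult)
    also have "\<dots> < k * r" using k strip[OF that] by simp
    also have "\<dots> = pi / 4" using r by (simp add: k_def)
    finally show ?thesis .
  qed
  have L: "L holomorphic_on ball 0 1" unfolding L_def by (intro holomorphic_intros F)
  have La: "L a = of_real (Re (L a))" by (simp add: L_def w0_def complex_eq_iff)
  have "(L has_field_derivative of_real k * deriv F a) (at a)"
    unfolding L_def using holomorphic_derivI[OF F _ a]
    by (auto intro!: derivative_eq_intros)
  from DERIV_chain[OF DERIV_tan[OF norm_tan_less_1(1)[OF ReL[OF a]]] this]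
  have deriv: "deriv (tan \<circ> L) a = inverse ((cos (L a))\<^sup>2) * (of_real k * deriv F a)"
    by (rule DERIV_imp_deriv)
  have "norm (cos (L a)) \<le> 1"
    by (subst La) (simp add: cos_of_real)
  then have "(norm (cos (L a)))\<^sup>2 \<le> 1" by (simp add: power_le_one)
  moreover have "(norm (cos (L a)))\<^sup>2 > 0" using norm_tan_less_1(1)[OF ReL[OF a]] by simp
  ultimately have "1 \<le> inverse ((norm (cos (L a)))\<^sup>2)" by (simp add: one_le_inverse)
  then have "1 * (k * norm (deriv F a)) \<le> inverse ((norm (cos (L a)))\<^sup>2) * (k * norm (deriv F a))"
    using k by (intro mult_right_mono) auto
  then have ge: "k * norm (deriv F a) \<le> norm (deriv (tan \<circ> L) a)"
    using k by (simp add: deriv norm_mult norm_inverse norm_power)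
  have "(1 - (norm a)\<^sup>2) * norm (deriv (tan \<circ> L) a) \<le> 1"
  proof (rule norm_deriv_le_disc_to_disc[OF _ _ a])
    show "tan \<circ> L holomorphic_on ball 0 1"
      by (rule holomorphic_on_compose[OF L]) (auto intro!: holomorphic_on_tan norm_tan_less_1(1) ReL)
    show "(tan \<circ> L) ` ball 0 1 \<subseteq> ball 0 1"
      using norm_tan_less_1(2)[OF ReL] by auto
  qed
  moreover have "1 - (norm a)\<^sup>2 \<ge> 0" using a by (simp add: abs_square_le_1)
  ultimately have "(1 - (norm a)\<^sup>2) * (k * norm (deriv F a)) \<le> 1"
    using ge mult_left_mono by (meson order_trans)
  then show ?thesis using r by (simp add: k_def field_simps)
qed

text \<open>
  The real part has values in a closed interval of length at most \<open>d\<close>. Widening it slightly gives an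
  open strip, of positive width even for constant functions.
\<close>

lemma norm_deriv_le_oscillation_Re:
  assumes F: "F holomorphic_on ball 0 1" and a: "a \<in> ball 0 1"
    and osc: "\<And>z w. z \<in> ball 0 1 \<Longrightarrow> w \<in> ball 0 1 \<Longrightarrow> Re (F z) - Re (F w) \<le> d"
  shows "pi * (1 - (norm a)\<^sup>2) * norm (deriv F a) \<le> 2 * d"
proof (rule field_le_epsilon)
  fix e :: real assume e: "e > 0"
  let ?V = "(\<lambda>z. Re (F z)) ` ball 0 1"
  have ne: "?V \<noteq> {}" by simp
  have "Re (F z) \<le> Re (F a) + d" "Re (F a) - d \<le> Re (F z)" if "z \<in> ball 0 1" for z
    using osc[OF that a] osc[OF a that] by auto
  then have bdd: "bdd_above ?V" "bdd_below ?V"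
    by (auto intro!: bdd_aboveI2 bdd_belowI2)
  have "Sup ?V \<le> Inf ?V + d"
  proof (rule cSup_least[OF ne])
    fix x assume x: "x \<in> ?V"
    have "x - d \<le> Inf ?V"
      by (rule cInf_greatest[OF ne]) (use x osc in \<open>force simp: algebra_simps\<close>)
    then show "x \<le> Inf ?V + d" by simp
  qed
  then have "\<bar>Re (F z) - (Sup ?V + Inf ?V) / 2\<bar> < d / 2 + e / 4" if "z \<in> ball 0 1" for z
  proof -
    have "Re (F z) \<le> Sup ?V" "Inf ?V \<le> Re (F z)"
      using that bdd by (auto intro: cSup_upper cInf_lower)
    with \<open>Sup ?V \<le> Inf ?V + d\<close> e show ?thesis by argo
  qed
  moreover have "d / 2 + e / 4 > 0" using osc[OF a a] e by simp
  ultimately have "pi * (1 - (norm a)\<^sup>2) * norm (deriv F a) \<le> 4 * (d / 2 + e / 4)"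
    by (intro norm_deriv_le_disc_to_strip[OF F _ _ a])
  then show "pi * (1 - (norm a)\<^sup>2) * norm (deriv F a) \<le> 2 * d + e" by simp
qed

section \<open>Harmonic maps of the disc\<close>

text \<open>
  The operator norm is tested on one vector \<open>v\<close> at a time; the scalar estimate is applied to the
  component of \<open>f\<close> in the direction of the image of \<open>v\<close>.
\<close>

lemma differential_norm_harmonic_map_le:
  fixes f :: "complex \<Rightarrow> real ^ 'n"
  assumes f: "harmonic_map_on (ball 0 1) f" and bdd: "bounded (f ` ball 0 1)" and a: "a \<in> ball 0 1"
  shows "pi * (1 - (norm a)\<^sup>2) * differential_norm f a \<le> 2 * diameter (f ` ball 0 1)"
proof -
  let ?d = "diameter (f ` ball 0 1)" and ?D = "frechet_derivative f (at a)"
  have pos: "pi * (1 - (norm a)\<^sup>2) > 0" using a by (simp add: abs_square_less_1)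
  have harm: "harmonic_on (ball 0 1) (\<lambda>x. f x $ i)" for i
    using f by (simp add: harmonic_map_on_def)
  have "\<exists>F. F holomorphic_on ball 0 1 \<and> (\<forall>z\<in>ball 0 1. Re (F z) = f z $ i)" for i
    by (rule harmonic_is_Re_holomorphic[OF harm[of i] open_ball convex_ball]) blast
  then have "\<exists>F. \<forall>i. F i holomorphic_on ball 0 1 \<and> (\<forall>z\<in>ball 0 1. Re (F i z) = f z $ i)"
    by (intro choice allI)
  then obtain F where F: "\<And>i. F i holomorphic_on ball 0 1"
    and ReF: "\<And>i z. z \<in> ball 0 1 \<Longrightarrow> Re (F i z) = f z $ i"
    by blast
  have "(\<lambda>x. f x \<bullet> b) differentiable (at a)" if b: "b \<in> Basis" for b
  proof -
    obtain i where "b = axis i 1" using b by (auto simp: Basis_vec_def)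
    moreover have "(\<lambda>x. f x $ i) differentiable (at a)"
      using harm[of i] a unfolding harmonic_on_def C2_on_def by blast
    ultimately show ?thesis by (simp add: inner_axis)
  qed
  then have "f differentiable (at a)"
    unfolding differentiable_componentwise_within[of f a UNIV] by blast
  then have D: "(f has_derivative ?D) (at a)" by (simp add: frechet_derivative_works)
  have "norm (?D v) \<le> 2 * ?d / (pi * (1 - (norm a)\<^sup>2)) * norm v" for v
  proof -
    \<comment> \<open>If the image of \<open>v\<close> is 0 then so is \<open>e\<close>, and the equations below still hold.\<close>
    define e where "e = sgn (?D v)"
    define Fe where "Fe = (\<lambda>z. \<Sum>i\<in>UNIV. of_real (e $ i) * F i z)"
    have Fe: "Fe holomorphic_on ball 0 1" unfolding Fe_def by (intro holomorphic_intros F)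
    have ReFe: "Re (Fe z) = e \<bullet> f z" if "z \<in> ball 0 1" for z
      using that by (simp add: Fe_def ReF inner_vec_def)
    have "((\<lambda>z. Re (Fe z)) has_derivative (\<lambda>v. Re (deriv Fe a * v))) (at a)"
      using holomorphic_derivI[OF Fe _ a] unfolding has_field_derivative_def
      by (intro derivative_intros) auto
    then have "((\<lambda>z. e \<bullet> f z) has_derivative (\<lambda>v. Re (deriv Fe a * v))) (at a)"
      by (rule has_derivative_transform_within_open[OF _ open_ball a]) (simp add: ReFe)
    moreover have "((\<lambda>z. e \<bullet> f z) has_derivative (\<lambda>v. e \<bullet> ?D v)) (at a)"
      by (intro derivative_intros D)
    ultimately have eq: "e \<bullet> ?D v = Re (deriv Fe a * v)"
      by (metis has_derivative_unique)
    have "norm e \<le> 1" by (simp add: e_def norm_sgn)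
    have "Re (Fe z) - Re (Fe w) \<le> ?d" if "z \<in> ball 0 1" "w \<in> ball 0 1" for z w
    proof -
      have "Re (Fe z) - Re (Fe w) = e \<bullet> (f z - f w)"
        by (simp only: ReFe[OF that(1)] ReFe[OF that(2)] inner_diff_right)
      also have "\<dots> \<le> norm e * norm (f z - f w)" by (rule norm_cauchy_schwarz)
      also have "\<dots> \<le> norm (f z - f w)"
        using \<open>norm e \<le> 1\<close> by (simp add: mult_left_le_one_le)
      also have "\<dots> \<le> ?d"
        using diameter_bounded_bound[OF bdd imageI[OF that(1)] imageI[OF that(2)]] by (simp add: dist_norm)
      finally show ?thesis .
    qed
    then have "pi * (1 - (norm a)\<^sup>2) * norm (deriv Fe a) \<le> 2 * ?d"
      by (intro norm_deriv_le_oscillation_Re[OF Fe a])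
    then have "norm (deriv Fe a) \<le> 2 * ?d / (pi * (1 - (norm a)\<^sup>2))"
      using pos by (simp add: pos_le_divide_eq mult.commute)
    moreover have "norm (?D v) = e \<bullet> ?D v"
      by (cases "?D v = 0") (simp_all add: e_def sgn_div_norm dot_square_norm power2_eq_square)
    moreover have "Re (deriv Fe a * v) \<le> norm (deriv Fe a) * norm v"
      by (metis complex_Re_le_cmod norm_mult)
    ultimately show ?thesis
      by (smt (verit) eq mult_right_mono norm_ge_zero)
  qed
  then have "differential_norm f a \<le> 2 * ?d / (pi * (1 - (norm a)\<^sup>2))"
    unfolding differential_norm_def by (rule onorm_le)
  then show ?thesis using pos by (simp add: pos_le_divide_eq mult.commute)
qed

theorem theorem11:
  fixes f :: "complex \<Rightarrow> real ^ 3"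
    and d :: real
  assumes "continuous_on (cball 0 1) f"
    and "harmonic_map_on (ball 0 1) f"
    and "rectifiable_on 0 (2 * pi) (\<lambda>t. f (cis t))"
    and "d = diameter (f ` ball 0 1)"
  shows "pi * differential_norm f 0 \<le> 2 * d \<and>
    (\<forall>z\<in>ball 0 1. pi * (1 - (norm z)\<^sup>2) * differential_norm f z \<le> 2 * d)"
proof -
  have "bounded (f ` cball 0 1)"
    using assms(1) by (intro compact_imp_bounded compact_continuous_image) auto
  then have "bounded (f ` ball 0 1)"
    by (rule bounded_subset) auto
  then have *: "pi * (1 - (norm z)\<^sup>2) * differential_norm f z \<le> 2 * d" if "z \<in> ball 0 1" for z
    unfolding assms(4) by (rule differential_norm_harmonic_map_le[OF assms(2) _ that])
  from this[of 0] show ?thesis using * by simp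
qed

end
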